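(* Let $\epsilon>0$, $\delta\in(0,1]$, $T\ge1$, $\alpha\ge1$, $\tau>0$. The multi-party resource sharing algorithm with clipping and adaptive sensitivity described in the context, run for $T$ iterations $t=0,\dots,T-1$ (with noise calibrated to $\epsilon,\delta$ as described there), is $(\epsilon,\delta)$-locally differentially private.
   Context: Setting. There are $K>1$ parties and $m\ge 1$ shared resources with publicly known capacity vector $c\in[0,\infty)^m$. Party $k$ has a private dataset $\mathcal D_k=\{A_k,B_k,b_k,u_k\}$ with $A_k\in\mathbb R^{m\times n_k}$, $B_k\in\mathbb R^{m_k\times n_k}$, $b_k\in\mathbb R^{m_k}$, $u_k\in\mathbb R^{n_k}$. For $\lambda\in\mathbb R^m$, the sub-problem of party $k$ is the linear program $$g(\lambda;\mathcal D_k)=\max_{x_k\in\mathbb R^{n_k},\,s_k\in\mathbb R^m}\{u_k^\top x_k-s_k^\top\lambda:\ A_kx_k\le s_k,\ B_kx_k\le b_k,\ 0\le s_k\le c\}$$ (the constraint $s_k\le c$ is assumed to be included for every party). Datasets are assumed to be such that this problem has an optimal solution for every $\lambda$; $\mathscr D$ denotes the set of all possible datasets of a single party. When the maximizer is not unique, $\arg\max$ denotes a fixed (measurable) selection. Algorithm with clipping and adaptive sensitivity. Let $\rho(\epsilon,\delta)=\left(\sqrt{\log(1/\delta)+\epsilon}-\sqrt{\log(1/\delta)}\right)^{2}$, $\bar c=\alpha c$, $\lambda^{(-1)}=\lambda^{(0)}=0$, and $\bar s_k^{(0)}=\bar c/K$ for $k=1,\dots,K$. With given step-sizes $\nu^{(t)}>0$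 and momentum parameter $\gamma\ge0$ ($\gamma=0$ meaning no momentum), at each iteration $t$ perform, for $k=1,\dots,K$ and $j=1,\dots,m$, $$(x_k^{(t)},s_k^{(t)})=\arg\max\, g(\lambda^{(t)};\mathcal D_k),$$ $$\tilde s_{k,j}^{(t)}=\min\{\bar s_{k,j}^{(t)},s_{k,j}^{(t)}\}+w_{k,j}^{(t)},\qquad w_{k,j}^{(t)}\sim\mathcal N\left(0,\frac{T\,m\,(\bar s_{k,j}^{(t)})^2}{2\rho(\epsilon,\delta)}\right),$$ $$\lambda^{(t+1)}=\lambda^{(t)}-\nu^{(t)}\Big(c-\sum_{k=1}^K\tilde s_k^{(t)}\Big)+\gamma\big(\lambda^{(t)}-\lambda^{(t-1)}\big),$$ $$\bar s_{k,j}^{(t+1)}=\bar c_j\,\frac{\max\{\min\{c_j,\tilde s_{k,j}^{(t)}\},\tau\}}{\sum_{k'=1}^K\max\{\min\{c_j,\tilde s_{k',j}^{(t)}\},\tau\}},$$ where, conditionally on the past, the noise variables $w_{k,j}^{(t)}$ are drawn independently over $k,j$. The outputs published by party $k$ are the noisy clipped allocations $\tilde s_k^{(t)}$. $\mathcal N(0,0)$ denotes the point mass at $0$. Local differential privacy. A randomized algorithm with random source $\omega\sim\mu$, taking a dataset $\mathcal D\in\mathscr D$ of a single party and returning $A(\omega,\mathcal D)\in\mathcal O$, is $(\epsilon,\delta)$-locally differentially private if for all $\mathcal D,\mathcal D'\in\mathscr D$ and all (measurable) $S\subseteq\mathcal O$, $$\mathbb P[A(\omega,\mathcal D)\in S]\le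 e^{\epsilon}\,\mathbb P[A(\omega,\mathcal D')\in S]+\delta .$$ The multi-party algorithm is $(\epsilon,\delta)$-locally differentially private if, for each party $k$ and any fixed datasets of the other parties, the randomized map from $\mathcal D_k$ to all the outputs published over the $T$ iterations is $(\epsilon,\delta)$-locally differentially private. *)

theory Defs
  imports "HOL-Probability.Probability" "Jordan_Normal_Form.Matrix"
begin

(* Vectors and matrices are those of Jordan_Normal_Form, because the dimensions of the private
   data may differ from dataset to dataset. *)
unbundle no vec_syntax
unbundle no inner_syntax

text \<open>A dataset carries its own dimensions: the number of private variables is the dimension of
  \<open>utility\<close> and the number of private constraints is the dimension of \<open>private_rhs\<close>.\<close>

datatype dataset = Dataset
  (resource_use: "real mat") (private_lhs: "real mat") (private_rhs: "real vec")
  (utility: "real vec")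

definition well_formed :: "nat \<Rightarrow> dataset \<Rightarrow> bool" where
  "well_formed m D \<longleftrightarrow>
     resource_use D \<in> carrier_mat m (dim_vec (utility D)) \<and>
     private_lhs D \<in> carrier_mat (dim_vec (private_rhs D)) (dim_vec (utility D))"

definition feasible :: "nat \<Rightarrow> real vec \<Rightarrow> dataset \<Rightarrow> real vec \<times> real vec \<Rightarrow> bool" where
  "feasible m c D = (\<lambda>(x, s).
     x \<in> carrier_vec (dim_vec (utility D)) \<and> s \<in> carrier_vec m \<and>
     resource_use D *\<^sub>v x \<le> s \<and> private_lhs D *\<^sub>v x \<le> private_rhs D \<and>
     0\<^sub>v m \<le> s \<and> s \<le> c)"

definition objective :: "real vec \<Rightarrow> dataset \<Rightarrow> real vec \<times> real vec \<Rightarrow> real" where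
  "objective l D = (\<lambda>(x, s). utility D \<bullet> x - s \<bullet> l)"

definition optimal :: "nat \<Rightarrow> real vec \<Rightarrow> real vec \<Rightarrow> dataset \<Rightarrow> real vec \<times> real vec \<Rightarrow> bool" where
  "optimal m c l D = is_arg_max (objective l D) (feasible m c D)"

definition possible_datasets :: "nat \<Rightarrow> real vec \<Rightarrow> dataset set" where
  "possible_datasets m c =
     {D. well_formed m D \<and> (\<forall>l\<in>carrier_vec m. \<exists>z. optimal m c l D z)}"

text \<open>A fixed choice of maximizers. Measurability in the multiplier is stated coordinatewise,
  with \<open>\<real>\<^sup>m\<close> represented as a product space.\<close>

definition argmax_selection ::
  "nat \<Rightarrow> real vec \<Rightarrow> (real vec \<Rightarrow> dataset \<Rightarrow> real vec \<times> real vec) \<Rightarrow> bool" where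
  "argmax_selection m c argmax \<longleftrightarrow> (\<forall>D\<in>possible_datasets m c.
     (\<forall>l\<in>carrier_vec m. optimal m c l D (argmax l D)) \<and>
     (\<forall>i<dim_vec (utility D).
        (\<lambda>f. fst (argmax (vec m f) D) $ i) \<in> borel_measurable (\<Pi>\<^sub>M j\<in>{..<m}. borel)) \<and>
     (\<forall>i<m.
        (\<lambda>f. snd (argmax (vec m f) D) $ i) \<in> borel_measurable (\<Pi>\<^sub>M j\<in>{..<m}. borel)))"

text \<open>A transcript \<open>h\<close> records the published noisy allocations; \<open>h (t, k, j)\<close> is
  \<open>\<tilde>s\<^sub>k\<^sub>,\<^sub>j\<close> at iteration \<open>t\<close>. Parties, resources and iterations are numbered from 0. The
  multipliers and the clipping thresholds are functions of the transcript.\<close>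

type_synonym transcript = "nat \<times> nat \<times> nat \<Rightarrow> real"

definition transcript_space :: "nat \<Rightarrow> nat \<Rightarrow> nat \<Rightarrow> transcript measure" where
  "transcript_space m K t = (\<Pi>\<^sub>M i\<in>{..<t} \<times> {..<K} \<times> {..<m}. borel)"

text \<open>In the update of the multiplier at \<open>t = 0\<close> truncated subtraction makes \<open>t - 1\<close> equal to
  \<open>0\<close>; this is correct since \<open>\<lambda>\<close> vanishes at both indices \<open>-1\<close> and \<open>0\<close>.\<close>

fun multiplier ::
  "nat \<Rightarrow> nat \<Rightarrow> real vec \<Rightarrow> (nat \<Rightarrow> real) \<Rightarrow> real \<Rightarrow> transcript \<Rightarrow> nat \<Rightarrow> real vec" where
  "multiplier m K c \<nu> \<gamma> h 0 = 0\<^sub>v m"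
| "multiplier m K c \<nu> \<gamma> h (Suc t) =
     multiplier m K c \<nu> \<gamma> h t
     - \<nu> t \<cdot>\<^sub>v (c - vec m (\<lambda>j. \<Sum>k<K. h (t, k, j)))
     + \<gamma> \<cdot>\<^sub>v (multiplier m K c \<nu> \<gamma> h t - multiplier m K c \<nu> \<gamma> h (t - 1))"

fun threshold ::
  "nat \<Rightarrow> real vec \<Rightarrow> real \<Rightarrow> real \<Rightarrow> transcript \<Rightarrow> nat \<Rightarrow> nat \<Rightarrow> nat \<Rightarrow> real" where
  "threshold K c \<alpha> \<tau> h 0 k j = \<alpha> * c $ j / real K"
| "threshold K c \<alpha> \<tau> h (Suc t) k j =
     \<alpha> * c $ j * (max (min (c $ j) (h (t, k, j))) \<tau>
       / (\<Sum>k'<K. max (min (c $ j) (h (t, k', j))) \<tau>))"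

definition privacy_budget :: "real \<Rightarrow> real \<Rightarrow> real" where
  "privacy_budget \<epsilon> \<delta> = (sqrt (ln (1 / \<delta>) + \<epsilon>) - sqrt (ln (1 / \<delta>)))\<^sup>2"

text \<open>The centred normal distribution with variance \<open>v \<ge> 0\<close>.\<close>

definition centred_normal :: "real \<Rightarrow> real measure" where
  "centred_normal v =
     (if v = 0 then return borel 0 else density lborel (normal_density 0 (sqrt v)))"

definition noise_law ::
  "nat \<Rightarrow> nat \<Rightarrow> real vec \<Rightarrow> real \<Rightarrow> real \<Rightarrow> nat \<Rightarrow> real \<Rightarrow> real \<Rightarrow> transcript \<Rightarrow> nat
     \<Rightarrow> (nat \<times> nat \<Rightarrow> real) measure" where
  "noise_law m K c \<alpha> \<tau> T \<epsilon> \<delta> h t =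
     (\<Pi>\<^sub>M (k, j)\<in>{..<K} \<times> {..<m}.
        centred_normal
          (real T * real m * (threshold K c \<alpha> \<tau> h t k j)\<^sup>2 / (2 * privacy_budget \<epsilon> \<delta>)))"

definition publish ::
  "nat \<Rightarrow> nat \<Rightarrow> real vec \<Rightarrow> real \<Rightarrow> real \<Rightarrow> (nat \<Rightarrow> real) \<Rightarrow> real
     \<Rightarrow> (real vec \<Rightarrow> dataset \<Rightarrow> real vec \<times> real vec) \<Rightarrow> (nat \<Rightarrow> dataset)
     \<Rightarrow> nat \<Rightarrow> transcript \<Rightarrow> (nat \<times> nat \<Rightarrow> real) \<Rightarrow> transcript" where
  "publish m K c \<alpha> \<tau> \<nu> \<gamma> argmax D t h w =
     (\<lambda>(t', k, j)\<in>{..<Suc t} \<times> {..<K} \<times> {..<m}.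
        if t' = t
        then min (threshold K c \<alpha> \<tau> h t k j)
               (snd (argmax (multiplier m K c \<nu> \<gamma> h t) (D k)) $ j) + w (k, j)
        else h (t', k, j))"

text \<open>\<open>run \<dots> D t\<close> is the joint law of everything published in the first \<open>t\<close> iterations when
  party \<open>k\<close> holds \<open>D k\<close>. \<open>T\<close> only enters through the calibration of the noise.\<close>

primrec run ::
  "nat \<Rightarrow> nat \<Rightarrow> real vec \<Rightarrow> real \<Rightarrow> real \<Rightarrow> (nat \<Rightarrow> real) \<Rightarrow> real \<Rightarrow> nat \<Rightarrow> real \<Rightarrow> real
     \<Rightarrow> (real vec \<Rightarrow> dataset \<Rightarrow> real vec \<times> real vec) \<Rightarrow> (nat \<Rightarrow> dataset)
     \<Rightarrow> nat \<Rightarrow> transcript measure" where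
  "run m K c \<alpha> \<tau> \<nu> \<gamma> T \<epsilon> \<delta> argmax D 0 = return (transcript_space m K 0) (\<lambda>_. undefined)"
| "run m K c \<alpha> \<tau> \<nu> \<gamma> T \<epsilon> \<delta> argmax D (Suc t) =
     do {
       h \<leftarrow> run m K c \<alpha> \<tau> \<nu> \<gamma> T \<epsilon> \<delta> argmax D t;
       w \<leftarrow> noise_law m K c \<alpha> \<tau> T \<epsilon> \<delta> h t;
       return (transcript_space m K (Suc t)) (publish m K c \<alpha> \<tau> \<nu> \<gamma> argmax D t h w)
     }"

text \<open>A randomized algorithm is represented by the law \<open>M D\<close> of its output \<open>A(\<omega>, D)\<close> on the
  output space \<open>\<O>\<close>, so \<open>measure (M D) S\<close> is the probability of \<open>A(\<omega>, D) \<in> S\<close>.\<close>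

definition locally_private ::
  "'d set \<Rightarrow> 'o measure \<Rightarrow> real \<Rightarrow> real \<Rightarrow> ('d \<Rightarrow> 'o measure) \<Rightarrow> bool" where
  "locally_private \<D> \<O> \<epsilon> \<delta> M \<longleftrightarrow>
     (\<forall>D\<in>\<D>. \<forall>D'\<in>\<D>. \<forall>S\<in>sets \<O>. measure (M D) S \<le> exp \<epsilon> * measure (M D') S + \<delta>)"

definition multiparty_locally_private ::
  "nat \<Rightarrow> 'd set \<Rightarrow> 'o measure \<Rightarrow> real \<Rightarrow> real \<Rightarrow> ((nat \<Rightarrow> 'd) \<Rightarrow> 'o measure) \<Rightarrow> bool" where
  "multiparty_locally_private K \<D> \<O> \<epsilon> \<delta> M \<longleftrightarrow>
     (\<forall>k<K. \<forall>D. (\<forall>i<K. i \<noteq> k \<longrightarrow> D i \<in> \<D>) \<longrightarrow>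
        locally_private \<D> \<O> \<epsilon> \<delta> (\<lambda>d. M (D(k := d))))"

end

theory Submission
  imports Defs
begin

text \<open>Exchanging the dataset of one party has no effect on the internal state of the algorithm once
  the published transcript is given: thresholds and multipliers are functions of the transcript. So
  the algorithm is an adaptive composition of \<open>T\<close> rounds of Gaussian noise. In each round only the
  \<open>m\<close> allocations of that party change. Clipping keeps both the old and the new value between 0 and
  the threshold, and the variance of the noise is proportional to the square of that same threshold.
  Measured in standard deviations, the change of an entry therefore has a square of at most
  \<open>2 * \<rho> / (T * m)\<close>, where \<open>\<rho>\<close> is the privacy budget, however the thresholds evolve
  (\<open>displacement_square_le\<close>).

  The loss is accounted for by the Renyi divergence of order \<open>a > 1\<close>, that is, by the \<open>a\<close>-th moment
  of the likelihood ratio. A shift \<open>\<theta>\<close> of a standard normal vector costs \<open>a * \<parallel>\<theta>\<parallel>\<^sup>2 / 2\<close>, and costs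
  add up over adaptive rounds, because the conditional moment of the last round is bounded uniformly
  in the past and can be integrated out first (\<open>renyi_bounded_gaussian_step\<close>). Over \<open>m\<close> entries and
  \<open>T\<close> rounds the total is at most \<open>a * \<rho>\<close> (\<open>law_renyi_bounded\<close>).

  A Markov-type estimate turns this into \<open>P S \<le> exp \<epsilon> * Q S + exp ((a - 1) * (a * \<rho> - \<epsilon>))\<close>
  (\<open>renyi_bounded_imp_hockey_stick\<close>). For \<open>\<delta> < 1\<close> the formula for \<open>\<rho>\<close> is the one for which
  the minimum of the last term over \<open>a\<close> is \<open>\<delta>\<close> (\<open>privacy_budget_order\<close>); for \<open>\<delta> = 1\<close> there is
  nothing to prove.

  An entry with zero threshold receives no noise at all, and its law has no density with respect to
  Lebesgue measure. Therefore the noise is written throughout as a multiple of standard normal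
  noise, and likelihood ratios are taken between laws of the latter. Zero noise does no harm, because
  clipping at 0 makes the published entry 0 for every dataset.\<close>

section \<open>Products of probability measures\<close>

text \<open>Both sides give a box the product of the probabilities of its preimages, and boxes determine
  a finite product measure.\<close>

lemma distr_PiM_componentwise:
  fixes M :: "'i \<Rightarrow> 'a measure" and N :: "'i \<Rightarrow> 'b measure"
  assumes fin: "finite I"
    and M: "\<And>i. i \<in> I \<Longrightarrow> prob_space (M i)"
    and f [measurable]: "\<And>i. i \<in> I \<Longrightarrow> f i \<in> M i \<rightarrow>\<^sub>M N i"
  shows "distr (Pi\<^sub>M I M) (Pi\<^sub>M I N) (\<lambda>x. \<lambda>i\<in>I. f i (x i)) = (\<Pi>\<^sub>M i\<in>I. distr (M i) (N i) (f i))"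
proof -
  let ?F = "\<lambda>x. \<lambda>i\<in>I. f i (x i)"
  define M' where "M' = (\<lambda>i. if i \<in> I then M i else return (count_space UNIV) undefined)"
  define L where "L = (\<lambda>i. if i \<in> I then distr (M i) (N i) (f i) else return (count_space UNIV) undefined)"
  have PM: "Pi\<^sub>M I M = Pi\<^sub>M I M'" and PL: "(\<Pi>\<^sub>M i\<in>I. distr (M i) (N i) (f i)) = Pi\<^sub>M I L"
    by (intro PiM_cong; simp add: M'_def L_def)+
  interpret M': product_prob_space M'
    by (rule product_prob_spaceI) (auto simp: M'_def intro!: prob_space_return M)
  interpret L: product_prob_space L
    by (rule product_prob_spaceI)
       (auto simp: L_def intro!: prob_space_return prob_space.prob_space_distr M)
  have [measurable]: "?F \<in> Pi\<^sub>M I M \<rightarrow>\<^sub>M Pi\<^sub>M I N"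
    by (intro measurable_restrict) measurable
  have sets: "sets (Pi\<^sub>M I N) = sets (Pi\<^sub>M I L)"
    by (intro sets_PiM_cong) (auto simp: L_def)
  have "distr (Pi\<^sub>M I M) (Pi\<^sub>M I N) ?F = Pi\<^sub>M I L"
  proof (rule L.PiM_eqI[OF fin])
    show "sets (distr (Pi\<^sub>M I M) (Pi\<^sub>M I N) ?F) = sets (Pi\<^sub>M I L)"
      by (simp add: sets)
  next
    fix A assume "\<And>i. i \<in> I \<Longrightarrow> A i \<in> sets (L i)"
    then have A [measurable]: "\<And>i. i \<in> I \<Longrightarrow> A i \<in> sets (N i)"
      by (auto simp: L_def)
    have "emeasure (distr (Pi\<^sub>M I M) (Pi\<^sub>M I N) ?F) (Pi\<^sub>E I A) =
        emeasure (Pi\<^sub>M I M) (?F -` Pi\<^sub>E I A \<inter> space (Pi\<^sub>M I M))"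
      by (intro emeasure_distr) (auto intro!: sets_PiM_I_finite fin A)
    also have "?F -` Pi\<^sub>E I A \<inter> space (Pi\<^sub>M I M) = Pi\<^sub>E I (\<lambda>i. f i -` A i \<inter> space (M i))"
      by (auto simp: space_PiM PiE_def Pi_def extensional_def)
    also have "emeasure (Pi\<^sub>M I M) \<dots> = (\<Prod>i\<in>I. emeasure (M i) (f i -` A i \<inter> space (M i)))"
      unfolding PM
      by (subst M'.emeasure_PiM) (auto simp: M'_def intro!: fin measurable_sets f A prod.cong)
    also have "\<dots> = (\<Prod>i\<in>I. emeasure (L i) (A i))"
      by (intro prod.cong) (auto simp: L_def emeasure_distr)
    finally show "emeasure (distr (Pi\<^sub>M I M) (Pi\<^sub>M I N) ?F) (Pi\<^sub>E I A) = \<dots>" .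
  qed
  then show ?thesis by (simp add: PL)
qed

lemma PiM_density:
  fixes M :: "'a measure"
  assumes fin: "finite I"
    and M: "prob_space M"
    and g [measurable]: "\<And>i. i \<in> I \<Longrightarrow> g i \<in> borel_measurable M"
    and dens: "\<And>i. i \<in> I \<Longrightarrow> prob_space (density M (g i))"
  shows "(\<Pi>\<^sub>M i\<in>I. density M (g i)) = density (\<Pi>\<^sub>M i\<in>I. M) (\<lambda>x. \<Prod>i\<in>I. g i (x i))"
proof -
  define L where "L = (\<lambda>i. if i \<in> I then density M (g i) else M)"
  have PL: "(\<Pi>\<^sub>M i\<in>I. density M (g i)) = Pi\<^sub>M I L"
    by (intro PiM_cong) (simp_all add: L_def)
  interpret M: product_prob_space "\<lambda>_. M"
    by (rule product_prob_spaceI) (rule M)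
  interpret L: product_prob_space L
    by (rule product_prob_spaceI) (auto simp: L_def intro: M dens)
  have sets: "sets (\<Pi>\<^sub>M i\<in>I. M) = sets (Pi\<^sub>M I L)"
    by (intro sets_PiM_cong) (auto simp: L_def)
  have [measurable]: "(\<lambda>x. \<Prod>i\<in>I. g i (x i)) \<in> borel_measurable (\<Pi>\<^sub>M i\<in>I. M)"
    by (intro borel_measurable_prod_ennreal) measurable
  have "density (\<Pi>\<^sub>M i\<in>I. M) (\<lambda>x. \<Prod>i\<in>I. g i (x i)) = Pi\<^sub>M I L"
  proof (rule L.PiM_eqI[OF fin])
    show "sets (density (\<Pi>\<^sub>M i\<in>I. M) (\<lambda>x. \<Prod>i\<in>I. g i (x i))) = sets (Pi\<^sub>M I L)"
      by (simp add: sets)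
  next
    fix A assume "\<And>i. i \<in> I \<Longrightarrow> A i \<in> sets (L i)"
    then have A [measurable]: "\<And>i. i \<in> I \<Longrightarrow> A i \<in> sets M"
      by (auto simp: L_def)
    have [measurable]: "Pi\<^sub>E I A \<in> sets (\<Pi>\<^sub>M i\<in>I. M)"
      by (intro sets_PiM_I_finite fin A)
    have "emeasure (density (\<Pi>\<^sub>M i\<in>I. M) (\<lambda>x. \<Prod>i\<in>I. g i (x i))) (Pi\<^sub>E I A) =
        (\<integral>\<^sup>+x. (\<Prod>i\<in>I. g i (x i)) * indicator (Pi\<^sub>E I A) x \<partial>(\<Pi>\<^sub>M i\<in>I. M))"
      by (rule emeasure_density) measurable
    also have "\<dots> = (\<integral>\<^sup>+x. (\<Prod>i\<in>I. g i (x i) * indicator (A i) (x i)) \<partial>(\<Pi>\<^sub>M i\<in>I. M))"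
    proof (rule nn_integral_cong)
      fix x assume x: "x \<in> space (\<Pi>\<^sub>M i\<in>I. M)"
      have "indicator (Pi\<^sub>E I A) x = (\<Prod>i\<in>I. indicator (A i) (x i) :: ennreal)"
        using x fin by (auto simp: indicator_def space_PiM PiE_def Pi_def prod_zero_iff)
      then show "(\<Prod>i\<in>I. g i (x i)) * indicator (Pi\<^sub>E I A) x = (\<Prod>i\<in>I. g i (x i) * indicator (A i) (x i))"
        by (simp add: prod.distrib)
    qed
    also have "\<dots> = (\<Prod>i\<in>I. \<integral>\<^sup>+x. g i x * indicator (A i) x \<partial>M)"
      by (rule M.product_nn_integral_prod[OF fin]) measurable
    also have "\<dots> = (\<Prod>i\<in>I. emeasure (L i) (A i))"
      by (intro prod.cong) (auto simp: L_def emeasure_density)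
    finally show "emeasure (density (\<Pi>\<^sub>M i\<in>I. M) (\<lambda>x. \<Prod>i\<in>I. g i (x i))) (Pi\<^sub>E I A) = \<dots>" .
  qed
  then show ?thesis by (simp add: PL)
qed

text \<open>Drawing noise in each round, as the monadic definition of the algorithm does, agrees with
  pushing forward the product of the past and the noise; on the product, densities can be computed.\<close>

lemma bind_distr_eq_distr_pair:
  assumes P: "prob_space P" and N: "prob_space N" and \<Phi> [measurable]: "\<Phi> \<in> P \<Otimes>\<^sub>M N \<rightarrow>\<^sub>M M"
  shows "P \<bind> (\<lambda>h. distr N M (\<lambda>z. \<Phi> (h, z))) = distr (P \<Otimes>\<^sub>M N) M \<Phi>"
proof -
  interpret P: prob_space P by (rule P)
  interpret N: prob_space N by (rule N)
  have kernel: "(\<lambda>h. distr N M (\<lambda>z. \<Phi> (h, z))) \<in> P \<rightarrow>\<^sub>M subprob_algebra M"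
    by (rule measurable_distr2[where M = N])
       (simp_all add: N.M_in_subprob split_beta')
  show ?thesis
  proof (rule measure_eqI)
    show "sets (P \<bind> (\<lambda>h. distr N M (\<lambda>z. \<Phi> (h, z)))) = sets (distr (P \<Otimes>\<^sub>M N) M \<Phi>)"
      by (simp add: sets_bind[OF _ P.not_empty])
    fix A assume "A \<in> sets (P \<bind> (\<lambda>h. distr N M (\<lambda>z. \<Phi> (h, z))))"
    then have A [measurable]: "A \<in> sets M"
      by (simp add: sets_bind[OF _ P.not_empty])
    have "emeasure (P \<bind> (\<lambda>h. distr N M (\<lambda>z. \<Phi> (h, z)))) A
        = (\<integral>\<^sup>+h. emeasure (distr N M (\<lambda>z. \<Phi> (h, z))) A \<partial>P)"
      by (rule emeasure_bind[OF P.not_empty kernel A])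
    also have "\<dots> = (\<integral>\<^sup>+h. \<integral>\<^sup>+z. indicator A (\<Phi> (h, z)) \<partial>N \<partial>P)"
    proof (rule nn_integral_cong)
      fix h assume [measurable]: "h \<in> space P"
      have "emeasure (distr N M (\<lambda>z. \<Phi> (h, z))) A = (\<integral>\<^sup>+y. indicator A y \<partial>distr N M (\<lambda>z. \<Phi> (h, z)))"
        by simp
      also have "\<dots> = (\<integral>\<^sup>+z. indicator A (\<Phi> (h, z)) \<partial>N)"
        by (rule nn_integral_distr) measurable
      finally show "emeasure (distr N M (\<lambda>z. \<Phi> (h, z))) A = (\<integral>\<^sup>+z. indicator A (\<Phi> (h, z)) \<partial>N)" .
    qed
    also have "\<dots> = (\<integral>\<^sup>+p. indicator A (\<Phi> p) \<partial>(P \<Otimes>\<^sub>M N))"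
      by (rule N.nn_integral_fst) measurable
    also have "\<dots> = (\<integral>\<^sup>+y. indicator A y \<partial>distr (P \<Otimes>\<^sub>M N) M \<Phi>)"
      by (rule nn_integral_distr[symmetric]) measurable
    finally show "emeasure (P \<bind> (\<lambda>h. distr N M (\<lambda>z. \<Phi> (h, z)))) A = emeasure (distr (P \<Otimes>\<^sub>M N) M \<Phi>) A"
      by simp
  qed
qed

section \<open>Shifts of standard normal noise\<close>

definition std_normal :: "real measure" where
  "std_normal = density lborel std_normal_density"

lemma prob_space_std_normal: "prob_space std_normal"
  unfolding std_normal_def by (rule prob_space_normal_density) simp

lemma sets_std_normal [measurable_cong, simp]: "sets std_normal = sets borel"
  and space_std_normal [simp]: "space std_normal = UNIV"
  by (simp_all add: std_normal_def)

lemma distr_std_normal_affine: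
  assumes "s \<noteq> 0"
  shows "distr std_normal borel (\<lambda>z. b + s * z) = density lborel (normal_density b \<bar>s\<bar>)"
proof -
  interpret prob_space std_normal by (rule prob_space_std_normal)
  have "distributed std_normal lborel (\<lambda>z. z) std_normal_density"
    unfolding distributed_def by (auto simp: std_normal_def distr_id2)
  from normal_density_affine[OF this, of s b] assms
  have "distributed std_normal lborel (\<lambda>z. b + s * z) (normal_density b \<bar>s\<bar>)"
    by simp
  then show ?thesis
    using distributed_distr_eq_density by (metis distr_cong sets_lborel)
qed

text \<open>Scaling a fixed source of noise also covers variance 0. A data-dependent noise law thereby
  becomes a measurable function of the past and of noise whose law does not depend on anything.\<close>

lemma centred_normal_eq_distr:
  "centred_normal v = distr std_normal borel (\<lambda>z. sqrt v * z)" if "v \<ge> 0"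
proof (cases "v = 0")
  case True
  interpret prob_space std_normal by (rule prob_space_std_normal)
  show ?thesis using True by (simp add: centred_normal_def distr_const)
next
  case False
  then show ?thesis using distr_std_normal_affine[of "sqrt v" 0] that
    by (simp add: centred_normal_def)
qed

text \<open>The density of \<open>\<N>(\<theta>, 1)\<close> with respect to \<open>\<N>(0, 1)\<close>.\<close>

definition shift_ratio :: "real \<Rightarrow> real \<Rightarrow> real" where
  "shift_ratio \<theta> z = exp (\<theta> * z - \<theta>\<^sup>2 / 2)"

lemma shift_ratio_measurable [measurable]:
  assumes [measurable]: "f \<in> borel_measurable M" "g \<in> borel_measurable M"
  shows "(\<lambda>x. shift_ratio (f x) (g x)) \<in> borel_measurable M"
  unfolding shift_ratio_def by measurable

lemma distr_std_normal_shift: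
  "distr std_normal borel (\<lambda>z. \<theta> + z) = density std_normal (\<lambda>z. ennreal (shift_ratio \<theta> z))"
proof -
  have "density std_normal (\<lambda>z. ennreal (shift_ratio \<theta> z))
      = density lborel (\<lambda>z. ennreal (std_normal_density z) * ennreal (shift_ratio \<theta> z))"
    unfolding std_normal_def by (rule density_density_eq) measurable
  also have "\<dots> = density lborel (normal_density \<theta> 1)"
  proof (rule density_cong)
    have "std_normal_density z * shift_ratio \<theta> z = normal_density \<theta> 1 z" for z
      by (simp add: normal_density_def shift_ratio_def exp_add[symmetric] power2_eq_square field_simps)
    then show "AE z in lborel. ennreal (std_normal_density z) * ennreal (shift_ratio \<theta> z) = ennreal (normal_density \<theta> 1 z)"
      by (simp add: ennreal_mult'[symmetric])
  qed measurable
  finally show ?thesis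
    using distr_std_normal_affine[of 1 \<theta>] by simp
qed

text \<open>The \<open>a\<close>-th power of the likelihood ratio for the shift \<open>\<theta>\<close> is a constant times the likelihood
  ratio for the shift \<open>a\<theta>\<close>, which has integral 1. The constant comes from completing the square.\<close>

lemma shift_ratio_moment:
  "(\<integral>\<^sup>+z. ennreal (shift_ratio \<theta> z powr a) \<partial>std_normal) = ennreal (exp (a * (a - 1) * \<theta>\<^sup>2 / 2))"
proof -
  have "(\<integral>\<^sup>+z. ennreal (shift_ratio \<theta> z powr a) \<partial>std_normal)
      = (\<integral>\<^sup>+z. ennreal (exp (a * (a - 1) * \<theta>\<^sup>2 / 2)) * ennreal (shift_ratio (a * \<theta>) z) \<partial>std_normal)"
  proof (rule nn_integral_cong)
    fix z
    have "a * (\<theta> * z - \<theta>\<^sup>2 / 2) = a * (a - 1) * \<theta>\<^sup>2 / 2 + (a * \<theta> * z - (a * \<theta>)\<^sup>2 / 2)"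
      by (simp add: power2_eq_square field_simps)
    then have "shift_ratio \<theta> z powr a = exp (a * (a - 1) * \<theta>\<^sup>2 / 2) * shift_ratio (a * \<theta>) z"
      by (simp add: shift_ratio_def powr_def exp_add[symmetric])
    then show "ennreal (shift_ratio \<theta> z powr a)
        = ennreal (exp (a * (a - 1) * \<theta>\<^sup>2 / 2)) * ennreal (shift_ratio (a * \<theta>) z)"
      by (simp add: ennreal_mult')
  qed
  also have "\<dots> = ennreal (exp (a * (a - 1) * \<theta>\<^sup>2 / 2)) * (\<integral>\<^sup>+z. ennreal (shift_ratio (a * \<theta>) z) \<partial>std_normal)"
    by (rule nn_integral_cmult) measurable
  also have "(\<integral>\<^sup>+z. ennreal (shift_ratio (a * \<theta>) z) \<partial>std_normal)
      = emeasure (density std_normal (\<lambda>z. ennreal (shift_ratio (a * \<theta>) z))) UNIV"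
    by (subst emeasure_density) auto
  also have "\<dots> = 1"
    unfolding distr_std_normal_shift[symmetric]
    using prob_space.emeasure_space_1[OF prob_space.prob_space_distr[OF prob_space_std_normal, of "\<lambda>z. a * \<theta> + z" borel]]
    by simp
  finally show ?thesis by simp
qed

definition std_normals :: "'i set \<Rightarrow> ('i \<Rightarrow> real) measure" where
  "std_normals I = (\<Pi>\<^sub>M i\<in>I. std_normal)"

definition translate :: "'i set \<Rightarrow> ('i \<Rightarrow> real) \<Rightarrow> ('i \<Rightarrow> real) \<Rightarrow> 'i \<Rightarrow> real" where
  "translate I \<theta> z = (\<lambda>i\<in>I. \<theta> i + z i)"

lemma prob_space_std_normals: "prob_space (std_normals I)"
  unfolding std_normals_def by (intro prob_space_PiM prob_space_std_normal)

lemma sets_std_normals [measurable_cong]: "sets (std_normals I) = sets (\<Pi>\<^sub>M i\<in>I. borel)"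
  unfolding std_normals_def by (intro sets_PiM_cong) simp_all

lemma measurable_translate [measurable]: "translate I \<theta> \<in> std_normals I \<rightarrow>\<^sub>M std_normals I"
  unfolding translate_def std_normals_def by (intro measurable_restrict) measurable

lemma distr_std_normals_shift:
  assumes "finite I"
  shows "distr (std_normals I) (std_normals I) (translate I \<theta>)
    = density (std_normals I) (\<lambda>z. ennreal (\<Prod>i\<in>I. shift_ratio (\<theta> i) (z i)))"
proof -
  have "distr (std_normals I) (std_normals I) (translate I \<theta>)
      = distr (std_normals I) (\<Pi>\<^sub>M i\<in>I. borel) (translate I \<theta>)"
    by (intro distr_cong sets_std_normals) auto
  also have "\<dots> = (\<Pi>\<^sub>M i\<in>I. distr std_normal borel (\<lambda>z. \<theta> i + z))"
    unfolding std_normals_def translate_def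
    by (rule distr_PiM_componentwise[OF assms prob_space_std_normal]) measurable
  also have "\<dots> = (\<Pi>\<^sub>M i\<in>I. density std_normal (\<lambda>z. ennreal (shift_ratio (\<theta> i) z)))"
    by (simp add: distr_std_normal_shift)
  also have "\<dots> = density (\<Pi>\<^sub>M i\<in>I. std_normal) (\<lambda>z. \<Prod>i\<in>I. ennreal (shift_ratio (\<theta> i) (z i)))"
  proof (rule PiM_density[OF assms prob_space_std_normal])
    show "prob_space (density std_normal (\<lambda>z. ennreal (shift_ratio (\<theta> i) z)))" for i
      unfolding distr_std_normal_shift[symmetric]
      by (rule prob_space.prob_space_distr[OF prob_space_std_normal]) measurable
  qed measurable
  finally show ?thesis
    by (simp add: std_normals_def prod_ennreal shift_ratio_def)
qed

lemma std_normals_shift_ratio_moment: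
  assumes "finite I"
  shows "(\<integral>\<^sup>+z. ennreal ((\<Prod>i\<in>I. shift_ratio (\<theta> i) (z i)) powr a) \<partial>std_normals I)
    = ennreal (exp (a * (a - 1) * (\<Sum>i\<in>I. (\<theta> i)\<^sup>2 / 2)))"
proof -
  interpret product_prob_space "\<lambda>_. std_normal"
    by (rule product_prob_spaceI) (rule prob_space_std_normal)
  have "(\<integral>\<^sup>+z. ennreal ((\<Prod>i\<in>I. shift_ratio (\<theta> i) (z i)) powr a) \<partial>std_normals I)
      = (\<integral>\<^sup>+z. (\<Prod>i\<in>I. ennreal (shift_ratio (\<theta> i) (z i) powr a)) \<partial>(\<Pi>\<^sub>M i\<in>I. std_normal))"
    by (simp add: std_normals_def prod_ennreal prod_powr_distrib shift_ratio_def)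
  also have "\<dots> = (\<Prod>i\<in>I. ennreal (exp (a * (a - 1) * (\<theta> i)\<^sup>2 / 2)))"
    by (subst product_nn_integral_prod[OF assms]) (simp_all add: shift_ratio_moment)
  also have "\<dots> = ennreal (exp (\<Sum>i\<in>I. a * (a - 1) * (\<theta> i)\<^sup>2 / 2))"
    by (simp add: prod_ennreal exp_sum assms)
  finally show ?thesis
    by (simp add: sum_distrib_left)
qed

section \<open>Bounded Renyi divergence\<close>

text \<open>For \<open>a > 1\<close> this says that the Renyi divergence of order \<open>a\<close> of \<open>P\<close> from \<open>Q\<close> is at most
  \<open>r\<close>. The density is real-valued so that its real powers make sense.\<close>

definition renyi_bounded :: "real \<Rightarrow> real \<Rightarrow> 'a measure \<Rightarrow> 'a measure \<Rightarrow> bool" where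
  "renyi_bounded a r P Q \<longleftrightarrow> (\<exists>f\<in>borel_measurable Q. (\<forall>x. 0 \<le> f x) \<and>
     P = density Q (\<lambda>x. ennreal (f x)) \<and>
     (\<integral>\<^sup>+x. ennreal (f x powr a) \<partial>Q) \<le> ennreal (exp ((a - 1) * r)))"

lemma renyi_bounded_refl:
  assumes "prob_space P"
  shows "renyi_bounded a 0 P P"
  unfolding renyi_bounded_def
  by (intro bexI[of _ "\<lambda>_. 1"])
     (simp_all add: density_1 prob_space.emeasure_space_1[OF assms])

text \<open>Where the likelihood ratio is at most \<open>exp \<epsilon>\<close> the first term on the right pays for it; where it
  is larger it is bounded by its \<open>a\<close>-th power times \<open>exp (- (a - 1) * \<epsilon>)\<close>, so a Markov-type estimate
  bounds the rest by the moment.\<close>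

lemma renyi_bounded_imp_hockey_stick:
  assumes r: "renyi_bounded a r P Q" and a: "1 < a"
    and P: "finite_measure P" and Q: "finite_measure Q"
    and S: "S \<in> sets Q"
  shows "measure P S \<le> exp \<epsilon> * measure Q S + exp ((a - 1) * (r - \<epsilon>))"
proof -
  from r obtain f where f [measurable]: "f \<in> borel_measurable Q" and f0: "\<And>x. 0 \<le> f x"
    and PQ: "P = density Q (\<lambda>x. ennreal (f x))"
    and moment: "(\<integral>\<^sup>+x. ennreal (f x powr a) \<partial>Q) \<le> ennreal (exp ((a - 1) * r))"
    unfolding renyi_bounded_def by blast
  note S [measurable]
  have pointwise: "y \<le> exp \<epsilon> + exp (- (a - 1) * \<epsilon>) * y powr a" if "0 \<le> y" for y
  proof (cases "y \<le> exp \<epsilon>")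
    case True
    then show ?thesis
      by (smt (verit) mult_nonneg_nonneg exp_ge_zero powr_ge_zero)
  next
    case False
    then have "0 < y" and "exp \<epsilon> \<le> y" using exp_gt_zero[of \<epsilon>] by linarith+
    have "1 = (exp \<epsilon>) powr (a - 1) * exp (- (a - 1) * \<epsilon>)"
      by (simp add: powr_def exp_add[symmetric] algebra_simps)
    also have "\<dots> \<le> y powr (a - 1) * exp (- (a - 1) * \<epsilon>)"
      using a \<open>exp \<epsilon> \<le> y\<close> by (intro mult_right_mono powr_mono2) auto
    finally have "y \<le> y * (y powr (a - 1) * exp (- (a - 1) * \<epsilon>))"
      using \<open>0 < y\<close> by (simp add: mult_le_cancel_left1)
    also have "\<dots> = exp (- (a - 1) * \<epsilon>) * y powr a"
      using \<open>0 < y\<close> by (simp add: powr_diff)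
    finally show ?thesis
      using exp_gt_zero[of \<epsilon>] by linarith
  qed
  have "emeasure P S = (\<integral>\<^sup>+x. ennreal (f x) * indicator S x \<partial>Q)"
    unfolding PQ by (rule emeasure_density) measurable
  also have "\<dots> \<le> (\<integral>\<^sup>+x. ennreal (exp \<epsilon>) * indicator S x
      + ennreal (exp (- (a - 1) * \<epsilon>)) * ennreal (f x powr a) \<partial>Q)"
  proof (rule nn_integral_mono)
    fix x
    show "ennreal (f x) * indicator S x
      \<le> ennreal (exp \<epsilon>) * indicator S x + ennreal (exp (- (a - 1) * \<epsilon>)) * ennreal (f x powr a)"
      using pointwise[OF f0, of x]
      by (cases "x \<in> S") (simp_all add: ennreal_mult'[symmetric] ennreal_plus[symmetric] del: ennreal_plus)
  qed
  also have "\<dots> = ennreal (exp \<epsilon>) * emeasure Q S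
      + ennreal (exp (- (a - 1) * \<epsilon>)) * (\<integral>\<^sup>+x. ennreal (f x powr a) \<partial>Q)"
    by (subst nn_integral_add) (simp_all add: nn_integral_cmult nn_integral_cmult_indicator)
  also have "\<dots> \<le> ennreal (exp \<epsilon>) * emeasure Q S
      + ennreal (exp (- (a - 1) * \<epsilon>)) * ennreal (exp ((a - 1) * r))"
    by (intro add_left_mono mult_left_mono moment) simp
  also have "ennreal (exp (- (a - 1) * \<epsilon>)) * ennreal (exp ((a - 1) * r))
      = ennreal (exp ((a - 1) * (r - \<epsilon>)))"
    by (simp add: ennreal_mult'[symmetric] exp_add[symmetric] algebra_simps)
  finally show ?thesis
    by (simp add: finite_measure.emeasure_eq_measure[OF P] finite_measure.emeasure_eq_measure[OF Q]
        ennreal_mult'[symmetric] ennreal_plus[symmetric] del: ennreal_plus)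
qed

text \<open>Noise that is independent of the past may be shifted by an amount that depends on the past:
  given the past, the shift is a constant.\<close>

lemma distr_pair_shift:
  assumes I: "finite I" and P: "prob_space P"
    and \<theta> [measurable]: "\<And>i. i \<in> I \<Longrightarrow> (\<lambda>h. \<theta> h i) \<in> borel_measurable P"
  shows "distr (P \<Otimes>\<^sub>M std_normals I) (P \<Otimes>\<^sub>M std_normals I) (\<lambda>(h, z). (h, translate I (\<theta> h) z))
    = density (P \<Otimes>\<^sub>M std_normals I) (\<lambda>(h, z). ennreal (\<Prod>i\<in>I. shift_ratio (\<theta> h i) (z i)))"
    (is "distr ?PN _ ?shift = density _ ?ratio")
proof (rule measure_eqI)
  interpret P: prob_space P by (rule P)
  interpret N: prob_space "std_normals I" by (rule prob_space_std_normals)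
  have [measurable]: "?shift \<in> ?PN \<rightarrow>\<^sub>M ?PN"
    unfolding translate_def split_beta' by measurable
  have [measurable]: "?ratio \<in> borel_measurable ?PN"
    unfolding split_beta' by measurable
  show "sets (distr ?PN ?PN ?shift) = sets (density ?PN ?ratio)" by simp
  fix A assume "A \<in> sets (distr ?PN ?PN ?shift)"
  then have A [measurable]: "A \<in> sets ?PN" by simp
  have "emeasure (distr ?PN ?PN ?shift) A = (\<integral>\<^sup>+p. indicator A p \<partial>distr ?PN ?PN ?shift)"
    by simp
  also have "\<dots> = (\<integral>\<^sup>+p. indicator A (?shift p) \<partial>?PN)"
    by (rule nn_integral_distr) measurable
  also have "\<dots> = (\<integral>\<^sup>+h. \<integral>\<^sup>+z. indicator A (h, translate I (\<theta> h) z) \<partial>std_normals I \<partial>P)"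
    by (subst N.nn_integral_fst[symmetric]) simp_all
  also have "\<dots> = (\<integral>\<^sup>+h. \<integral>\<^sup>+z. ?ratio (h, z) * indicator A (h, z) \<partial>std_normals I \<partial>P)"
  proof (rule nn_integral_cong)
    fix h assume [measurable]: "h \<in> space P"
    have "(\<integral>\<^sup>+z. indicator A (h, translate I (\<theta> h) z) \<partial>std_normals I)
        = (\<integral>\<^sup>+z. indicator A (h, z) \<partial>distr (std_normals I) (std_normals I) (translate I (\<theta> h)))"
      by (subst nn_integral_distr) measurable
    also have "\<dots> = (\<integral>\<^sup>+z. ?ratio (h, z) * indicator A (h, z) \<partial>std_normals I)"
      unfolding distr_std_normals_shift[OF I] by (subst nn_integral_density) simp_all
    finally show "(\<integral>\<^sup>+z. indicator A (h, translate I (\<theta> h) z) \<partial>std_normals I) = \<dots>" .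
  qed
  also have "\<dots> = (\<integral>\<^sup>+p. ?ratio p * indicator A p \<partial>?PN)"
    by (subst N.nn_integral_fst[symmetric]) simp_all
  also have "\<dots> = emeasure (density ?PN ?ratio) A"
    by (simp add: emeasure_density)
  finally show "emeasure (distr ?PN ?PN ?shift) A = emeasure (density ?PN ?ratio) A" .
qed

text \<open>One round of adaptive composition. Both laws of the past are continued by the same map \<open>\<Phi>\<close> of
  past and noise, but on one side the noise is shifted by \<open>\<theta>\<close>. The likelihood ratio on pairs (past,
  noise) is the product of the old one and that of the shift, so the moments multiply: the inner
  integral over the noise is at most \<open>exp (a * (a - 1) * s)\<close> for every past.

  Such a bound passes from pairs to the values of \<open>\<Phi>\<close> because the likelihood ratio is a function of
  the output. For this \<open>past\<close> must recover the past, and \<open>noise\<close> must recover the noise in those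
  coordinates that are shifted; elsewhere the ratio does not depend on the noise. The exception is
  what admits coordinates published without noise.\<close>

lemma renyi_bounded_gaussian_step:
  fixes \<Phi> :: "'h \<times> ('i \<Rightarrow> real) \<Rightarrow> 'o"
  assumes PQ: "renyi_bounded a r P Q" and P: "prob_space P" and Q: "prob_space Q" and a: "1 \<le> a"
    and I: "finite I"
    and \<theta> [measurable]: "\<And>i. i \<in> I \<Longrightarrow> (\<lambda>h. \<theta> h i) \<in> borel_measurable Q"
    and s: "\<And>h. h \<in> space Q \<Longrightarrow> (\<Sum>i\<in>I. (\<theta> h i)\<^sup>2 / 2) \<le> s"
    and \<Phi> [measurable]: "\<Phi> \<in> Q \<Otimes>\<^sub>M std_normals I \<rightarrow>\<^sub>M M"
    and past [measurable]: "past \<in> M \<rightarrow>\<^sub>M Q"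
    and past_\<Phi>: "\<And>h z. h \<in> space Q \<Longrightarrow> z \<in> space (std_normals I) \<Longrightarrow> past (\<Phi> (h, z)) = h"
    and noise [measurable]: "\<And>i. i \<in> I \<Longrightarrow> (\<lambda>y. noise y i) \<in> borel_measurable M"
    and noise_\<Phi>: "\<And>h z i. h \<in> space Q \<Longrightarrow> z \<in> space (std_normals I) \<Longrightarrow> i \<in> I \<Longrightarrow>
      \<theta> h i \<noteq> 0 \<Longrightarrow> noise (\<Phi> (h, z)) i = z i"
  shows "renyi_bounded a (r + a * s)
    (distr (P \<Otimes>\<^sub>M std_normals I) M (\<lambda>(h, z). \<Phi> (h, translate I (\<theta> h) z)))
    (distr (Q \<Otimes>\<^sub>M std_normals I) M \<Phi>)"
proof -
  interpret P: prob_space P by (rule P)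
  interpret Q: prob_space Q by (rule Q)
  interpret N: prob_space "std_normals I" by (rule prob_space_std_normals)
  let ?QN = "Q \<Otimes>\<^sub>M std_normals I" and ?PN = "P \<Otimes>\<^sub>M std_normals I"
  from PQ obtain f where f [measurable]: "f \<in> borel_measurable Q" and f0: "\<And>x. 0 \<le> f x"
    and P_eq: "P = density Q (\<lambda>x. ennreal (f x))"
    and moment: "(\<integral>\<^sup>+x. ennreal (f x powr a) \<partial>Q) \<le> ennreal (exp ((a - 1) * r))"
    unfolding renyi_bounded_def by blast
  have sets_P [measurable_cong]: "sets P = sets Q"
    by (simp add: P_eq)
  define G where "G h z = (\<Prod>i\<in>I. shift_ratio (\<theta> h i) (z i))" for h z
  have G0: "0 \<le> G h z" for h z
    by (simp add: G_def shift_ratio_def prod_nonneg)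
  have G_meas [measurable]: "(\<lambda>(h, z). G h z) \<in> borel_measurable ?QN"
    unfolding G_def split_beta' by measurable
  define g where "g y = f (past y) * G (past y) (noise y)" for y
  have g [measurable]: "g \<in> borel_measurable M"
    unfolding g_def G_def by measurable
  have g0: "0 \<le> g y" for y
    by (simp add: g_def f0 G0)
  have g_\<Phi>: "g (\<Phi> (h, z)) = f h * G h z"
    if "h \<in> space Q" "z \<in> space (std_normals I)" for h z
  proof -
    have "shift_ratio (\<theta> h i) (noise (\<Phi> (h, z)) i) = shift_ratio (\<theta> h i) (z i)" if "i \<in> I" for i
      using noise_\<Phi>[of h z i] that \<open>h \<in> space Q\<close> \<open>z \<in> space (std_normals I)\<close>
      by (cases "\<theta> h i = 0") (simp_all add: shift_ratio_def)
    then show ?thesis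
      using that by (simp add: g_def G_def past_\<Phi> cong: prod.cong)
  qed
  have shift_meas [measurable]: "(\<lambda>(h, z). (h, translate I (\<theta> h) z)) \<in> ?PN \<rightarrow>\<^sub>M ?PN"
    unfolding translate_def split_beta' by measurable

  have PN: "?PN = density ?QN (\<lambda>(h, z). ennreal (f h))"
  proof -
    have "?PN = density Q (\<lambda>x. ennreal (f x)) \<Otimes>\<^sub>M density (std_normals I) (\<lambda>_. 1)"
      by (simp add: P_eq density_1)
    also have "\<dots> = density ?QN (\<lambda>(h, z). ennreal (f h) * 1)"
      by (rule pair_measure_density) (simp_all add: density_1 N.sigma_finite_measure_axioms)
    finally show ?thesis by simp
  qed
  have "distr ?PN M (\<lambda>(h, z). \<Phi> (h, translate I (\<theta> h) z))
      = distr (distr ?PN ?PN (\<lambda>(h, z). (h, translate I (\<theta> h) z))) M \<Phi>"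
    by (subst distr_distr) (auto simp: comp_def split_beta' intro!: distr_cong)
  also have "distr ?PN ?PN (\<lambda>(h, z). (h, translate I (\<theta> h) z)) = density ?PN (\<lambda>(h, z). ennreal (G h z))"
    unfolding G_def by (rule distr_pair_shift[OF I P]) measurable
  also have "\<dots> = density ?QN (\<lambda>p. (case p of (h, z) \<Rightarrow> ennreal (f h)) * (case p of (h, z) \<Rightarrow> ennreal (G h z)))"
    unfolding PN by (rule density_density_eq) measurable
  also have "\<dots> = density ?QN (\<lambda>p. ennreal (g (\<Phi> p)))"
    by (intro density_cong AE_I2)
       (auto simp: space_pair_measure g_\<Phi> ennreal_mult' f0)
  also have "distr \<dots> M \<Phi> = density (distr ?QN M \<Phi>) (\<lambda>y. ennreal (g y))"
    by (rule density_distr[symmetric]) measurable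
  finally have eq: "distr ?PN M (\<lambda>(h, z). \<Phi> (h, translate I (\<theta> h) z))
      = density (distr ?QN M \<Phi>) (\<lambda>y. ennreal (g y))" .

  have "(\<integral>\<^sup>+y. ennreal (g y powr a) \<partial>distr ?QN M \<Phi>) = (\<integral>\<^sup>+p. ennreal (g (\<Phi> p) powr a) \<partial>?QN)"
    by (rule nn_integral_distr) measurable
  also have "\<dots> = (\<integral>\<^sup>+h. \<integral>\<^sup>+z. ennreal (g (\<Phi> (h, z)) powr a) \<partial>std_normals I \<partial>Q)"
    by (rule N.nn_integral_fst[symmetric]) measurable
  also have "\<dots> \<le> (\<integral>\<^sup>+h. ennreal (f h powr a) * ennreal (exp (a * (a - 1) * s)) \<partial>Q)"
  proof (rule nn_integral_mono)
    fix h assume h: "h \<in> space Q"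
    have [measurable]: "G h \<in> borel_measurable (std_normals I)"
      unfolding G_def by measurable
    have "(\<integral>\<^sup>+z. ennreal (g (\<Phi> (h, z)) powr a) \<partial>std_normals I)
        = (\<integral>\<^sup>+z. ennreal (f h powr a) * ennreal (G h z powr a) \<partial>std_normals I)"
      by (intro nn_integral_cong) (simp add: g_\<Phi> h powr_mult f0 G0 ennreal_mult')
    also have "\<dots> = ennreal (f h powr a) * (\<integral>\<^sup>+z. ennreal (G h z powr a) \<partial>std_normals I)"
      by (rule nn_integral_cmult) measurable
    also have "(\<integral>\<^sup>+z. ennreal (G h z powr a) \<partial>std_normals I)
        = ennreal (exp (a * (a - 1) * (\<Sum>i\<in>I. (\<theta> h i)\<^sup>2 / 2)))"
      unfolding G_def by (rule std_normals_shift_ratio_moment[OF I])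
    also have "\<dots> \<le> ennreal (exp (a * (a - 1) * s))"
      using a s[OF h] by (intro ennreal_leI) (simp add: mult_left_mono)
    finally show "(\<integral>\<^sup>+z. ennreal (g (\<Phi> (h, z)) powr a) \<partial>std_normals I)
        \<le> ennreal (f h powr a) * ennreal (exp (a * (a - 1) * s))"
      by (simp add: mult_left_mono)
  qed
  also have "\<dots> = (\<integral>\<^sup>+h. ennreal (f h powr a) \<partial>Q) * ennreal (exp (a * (a - 1) * s))"
    by (rule nn_integral_multc) measurable
  also have "\<dots> \<le> ennreal (exp ((a - 1) * r)) * ennreal (exp (a * (a - 1) * s))"
    by (rule mult_right_mono[OF moment]) simp
  also have "\<dots> = ennreal (exp ((a - 1) * (r + a * s)))"
    by (simp add: ennreal_mult'[symmetric] exp_add[symmetric] algebra_simps)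
  finally show ?thesis
    unfolding renyi_bounded_def using eq g0 g by (intro bexI[of _ g]) auto
qed

section \<open>The privacy budget\<close>

lemma privacy_budget_pos:
  assumes "0 < \<epsilon>" "0 < \<delta>" "\<delta> \<le> 1"
  shows "0 < privacy_budget \<epsilon> \<delta>"
proof -
  have "0 \<le> ln (1 / \<delta>)" using assms by simp
  then have "sqrt (ln (1 / \<delta>)) < sqrt (ln (1 / \<delta>) + \<epsilon>)"
    using assms by simp
  then show ?thesis by (simp add: privacy_budget_def)
qed

text \<open>With \<open>l\<^sup>2 = ln (1 / \<delta>)\<close> and \<open>q\<^sup>2\<close> the budget, the definition of the budget reads
  \<open>\<epsilon> = q\<^sup>2 + 2lq\<close>. The quadratic \<open>(a - 1)(aq\<^sup>2 - \<epsilon>)\<close> in \<open>a\<close> then has its minimum \<open>-l\<^sup>2\<close> at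
  \<open>a = 1 + l / q\<close>. This exceeds 1 only if \<open>\<delta> < 1\<close>.\<close>

lemma privacy_budget_order:
  assumes "0 < \<epsilon>" "0 < \<delta>" "\<delta> < 1"
  obtains a where "1 < a" "exp ((a - 1) * (a * privacy_budget \<epsilon> \<delta> - \<epsilon>)) = \<delta>"
proof
  define l where "l = sqrt (ln (1 / \<delta>))"
  define q where "q = sqrt (ln (1 / \<delta>) + \<epsilon>) - l"
  have L: "0 < ln (1 / \<delta>)" using assms by simp
  then have l: "0 < l" and l2: "l\<^sup>2 = ln (1 / \<delta>)"
    by (simp_all add: l_def)
  have q: "0 < q"
    using assms L by (simp add: q_def l_def)
  have "(q + l)\<^sup>2 = ln (1 / \<delta>) + \<epsilon>"
    using assms L by (simp add: q_def)
  then have eps: "\<epsilon> = q\<^sup>2 + 2 * l * q"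
    using l2 by (simp add: power2_eq_square algebra_simps)
  have \<rho>: "privacy_budget \<epsilon> \<delta> = q\<^sup>2"
    by (simp add: privacy_budget_def q_def l_def)
  show "1 < 1 + l / q" using l q by simp
  have "(1 + l / q - 1) * ((1 + l / q) * q\<^sup>2 - \<epsilon>) = - l\<^sup>2"
    using q by (simp add: eps power2_eq_square field_simps)
  then show "exp ((1 + l / q - 1) * ((1 + l / q) * privacy_budget \<epsilon> \<delta> - \<epsilon>)) = \<delta>"
    using assms by (simp add: \<rho> l2 ln_div)
qed

section \<open>The law of the published transcript\<close>

locale resource_sharing =
  fixes m K T :: nat and c :: "real vec" and \<alpha> \<tau> \<gamma> \<epsilon> \<delta> :: real and \<nu> :: "nat \<Rightarrow> real"
    and argmax :: "real vec \<Rightarrow> dataset \<Rightarrow> real vec \<times> real vec"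
  assumes c_dim: "c \<in> carrier_vec m" and c_nonneg: "0\<^sub>v m \<le> c"
    and selection: "argmax_selection m c argmax"
    and m_pos: "0 < m" and T_pos: "0 < T"
    and \<alpha>_nonneg: "0 \<le> \<alpha>" and \<tau>_pos: "0 < \<tau>"
    and \<rho>_pos: "0 < privacy_budget \<epsilon> \<delta>"
begin

abbreviation entries :: "(nat \<times> nat) set" where "entries \<equiv> {..<K} \<times> {..<m}"
abbreviation histories :: "nat \<Rightarrow> transcript measure" where "histories \<equiv> transcript_space m K"
abbreviation thr :: "transcript \<Rightarrow> nat \<Rightarrow> nat \<Rightarrow> nat \<Rightarrow> real" where "thr \<equiv> threshold K c \<alpha> \<tau>"
abbreviation mult :: "transcript \<Rightarrow> nat \<Rightarrow> real vec" where "mult \<equiv> multiplier m K c \<nu> \<gamma>"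
abbreviation datasets :: "dataset set" where "datasets \<equiv> possible_datasets m c"
abbreviation law :: "(nat \<Rightarrow> dataset) \<Rightarrow> nat \<Rightarrow> transcript measure" where
  "law \<equiv> run m K c \<alpha> \<tau> \<nu> \<gamma> T \<epsilon> \<delta> argmax"
abbreviation pub :: "(nat \<Rightarrow> dataset) \<Rightarrow> nat \<Rightarrow> transcript \<Rightarrow> (nat \<times> nat \<Rightarrow> real) \<Rightarrow> transcript" where
  "pub \<equiv> publish m K c \<alpha> \<tau> \<nu> \<gamma> argmax"

definition noise_sd :: "nat \<Rightarrow> transcript \<Rightarrow> nat \<times> nat \<Rightarrow> real" where
  "noise_sd t h = (\<lambda>(k, j). sqrt (real T * real m * (thr h t k j)\<^sup>2 / (2 * privacy_budget \<epsilon> \<delta>)))"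

definition clipped :: "(nat \<Rightarrow> dataset) \<Rightarrow> nat \<Rightarrow> transcript \<Rightarrow> nat \<times> nat \<Rightarrow> real" where
  "clipped D t h = (\<lambda>(k, j). min (thr h t k j) (snd (argmax (mult h t) (D k)) $ j))"

text \<open>The source of randomness is taken to be standard normal, so that its law does not depend on the
  transcript and an iteration is a fixed map on a product space.\<close>

definition iterate :: "(nat \<Rightarrow> dataset) \<Rightarrow> nat \<Rightarrow> transcript \<times> (nat \<times> nat \<Rightarrow> real) \<Rightarrow> transcript" where
  "iterate D t = (\<lambda>(h, z). pub D t h (\<lambda>i\<in>entries. noise_sd t h i * z i))"

lemma iterate_apply:
  "iterate D t (h, z) =
    (\<lambda>(t', i)\<in>{..<Suc t} \<times> entries. if t' = t then clipped D t h i + noise_sd t h i * z i else h (t', i))"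
  by (rule ext)
     (auto simp: iterate_def publish_def clipped_def noise_sd_def restrict_def split: prod.splits)

lemma c_nonneg_component: "j < m \<Longrightarrow> 0 \<le> c $ j"
  using c_nonneg c_dim by (auto simp: less_eq_vec_def)

lemma thr_nonneg: "j < m \<Longrightarrow> 0 \<le> thr h t k j"
proof (cases t)
  case 0
  then show "j < m \<Longrightarrow> ?thesis" by (simp add: c_nonneg_component \<alpha>_nonneg)
next
  case (Suc t')
  have "0 \<le> max x \<tau>" for x using \<tau>_pos by simp
  then show "j < m \<Longrightarrow> ?thesis" unfolding Suc threshold.simps
    by (intro mult_nonneg_nonneg divide_nonneg_nonneg sum_nonneg) (simp_all add: c_nonneg_component \<alpha>_nonneg)
qed

lemma mult_dim [simp]: "mult h t \<in> carrier_vec m"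
  using c_dim by (induction t rule: less_induct) (case_tac x; simp)

lemma dim_mult [simp]: "dim_vec (mult h t) = m"
  using mult_dim by (rule carrier_vecD)

lemma measurable_history [measurable (raw)]:
  assumes "t' < t" "k < K" "j < m"
  shows "(\<lambda>h. h (t', k, j)) \<in> borel_measurable (histories t)"
  unfolding transcript_space_def using assms by (intro measurable_component_singleton) auto

lemma measurable_thr:
  assumes "t' \<le> t" "k < K" "j < m"
  shows "(\<lambda>h. thr h t' k j) \<in> borel_measurable (histories t)"
proof (cases t')
  case 0
  then show ?thesis by simp
next
  case (Suc n)
  have [measurable]: "(\<lambda>h. h (n, k', j)) \<in> borel_measurable (histories t)" if "k' < K" for k'
    using assms Suc that by (intro measurable_history) auto
  have [measurable]: "(\<lambda>h. h (n, k, j)) \<in> borel_measurable (histories t)"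
    using assms by simp
  have [measurable]: "(\<lambda>h. \<Sum>k'<K. max (min (c $ j) (h (n, k', j))) \<tau>) \<in> borel_measurable (histories t)"
    by (intro borel_measurable_sum borel_measurable_max borel_measurable_min) auto
  show ?thesis unfolding Suc threshold.simps by measurable
qed

lemma measurable_mult:
  assumes "t' \<le> t" "j < m"
  shows "(\<lambda>h. mult h t' $ j) \<in> borel_measurable (histories t)"
  using assms(1)
proof (induction t' rule: less_induct)
  case (less t')
  show ?case
  proof (cases t')
    case 0
    then show ?thesis using assms by simp
  next
    case (Suc n)
    have [measurable]: "(\<lambda>h. mult h n $ j) \<in> borel_measurable (histories t)"
      "(\<lambda>h. mult h (n - 1) $ j) \<in> borel_measurable (histories t)"
      using less.IH[of n] less.IH[of "n - 1"] less.prems Suc by auto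
    have [measurable]: "(\<lambda>h. \<Sum>k<K. h (n, k, j)) \<in> borel_measurable (histories t)"
      using assms less.prems Suc by (intro borel_measurable_sum measurable_history) auto
    have "mult h t' $ j = mult h n $ j - \<nu> n * (c $ j - (\<Sum>k<K. h (n, k, j)))
        + \<gamma> * (mult h n $ j - mult h (n - 1) $ j)" for h
      using carrier_vecD[OF c_dim] assms(2) unfolding Suc by simp
    then show ?thesis by (simp only:) measurable
  qed
qed

text \<open>The selection is measurable in the coordinates of the multiplier, and the multiplier is a
  vector assembled from these coordinates.\<close>

lemma measurable_clipped:
  assumes D: "D \<in> {..<K} \<rightarrow> datasets" and "i \<in> entries"
  shows "(\<lambda>h. clipped D t h i) \<in> borel_measurable (histories t)"
proof -
  obtain k j where i: "i = (k, j)" "k < K" "j < m" using assms by auto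
  have [measurable]: "(\<lambda>h. thr h t k j) \<in> borel_measurable (histories t)"
    using i by (intro measurable_thr) auto
  have [measurable]: "(\<lambda>h. \<lambda>j\<in>{..<m}. mult h t $ j) \<in> histories t \<rightarrow>\<^sub>M (\<Pi>\<^sub>M j\<in>{..<m}. borel)"
    by (intro measurable_restrict measurable_mult) auto
  have "(\<lambda>f. snd (argmax (vec m f) (D k)) $ j) \<in> borel_measurable (\<Pi>\<^sub>M j\<in>{..<m}. borel)"
    using selection funcset_mem[OF D, of k] i by (auto simp: argmax_selection_def)
  from measurable_compose[OF _ this]
  have "(\<lambda>h. snd (argmax (vec m (\<lambda>j\<in>{..<m}. mult h t $ j)) (D k)) $ j) \<in> borel_measurable (histories t)"
    by measurable
  also have "(\<lambda>h. vec m (\<lambda>j\<in>{..<m}. mult h t $ j)) = (\<lambda>h. mult h t)"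
  proof
    show "vec m (\<lambda>j\<in>{..<m}. mult h t $ j) = mult h t" for h
      by (intro eq_vecI) auto
  qed
  then have "(\<lambda>h. snd (argmax (vec m (\<lambda>j\<in>{..<m}. mult h t $ j)) (D k)) $ j)
      = (\<lambda>h. snd (argmax (mult h t) (D k)) $ j)"
    by (simp add: fun_eq_iff)
  finally show ?thesis
    by (simp add: clipped_def i)
qed

lemma measurable_noise_sd:
  assumes "i \<in> entries"
  shows "(\<lambda>h. noise_sd t h i) \<in> borel_measurable (histories t)"
proof -
  obtain k j where i: "i = (k, j)" "k < K" "j < m" using assms by auto
  have [measurable]: "(\<lambda>h. thr h t k j) \<in> borel_measurable (histories t)"
    using i by (intro measurable_thr) auto
  show ?thesis unfolding noise_sd_def i by simp
qed

lemma clipped_bounds: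
  assumes "D k \<in> datasets" "k < K" "j < m"
  shows "0 \<le> clipped D t h (k, j)" "clipped D t h (k, j) \<le> thr h t k j"
proof -
  have "optimal m c (mult h t) (D k) (argmax (mult h t) (D k))"
    using selection assms by (auto simp: argmax_selection_def)
  then have "feasible m c (D k) (argmax (mult h t) (D k))"
    by (simp add: optimal_def is_arg_max_def)
  then have "0\<^sub>v m \<le> snd (argmax (mult h t) (D k))"
    by (auto simp: feasible_def split: prod.splits)
  then have "0 \<le> snd (argmax (mult h t) (D k)) $ j"
    using assms by (auto simp: less_eq_vec_def)
  then show "0 \<le> clipped D t h (k, j)"
    using thr_nonneg[of j h t k] assms by (simp add: clipped_def)
  show "clipped D t h (k, j) \<le> thr h t k j"
    by (simp add: clipped_def)
qed

lemma measurable_iterate: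
  assumes D: "D \<in> {..<K} \<rightarrow> datasets"
  shows "iterate D t \<in> histories t \<Otimes>\<^sub>M std_normals entries \<rightarrow>\<^sub>M histories (Suc t)"
  unfolding transcript_space_def[of m K "Suc t"]
proof (subst measurable_cong)
  show "iterate D t p = (\<lambda>q\<in>{..<Suc t} \<times> entries. if fst q = t
      then clipped D t (fst p) (snd q) + noise_sd t (fst p) (snd q) * snd p (snd q) else fst p q)" for p
    by (cases p) (auto simp: iterate_apply split_beta)
  show "(\<lambda>p. \<lambda>q\<in>{..<Suc t} \<times> entries. if fst q = t
      then clipped D t (fst p) (snd q) + noise_sd t (fst p) (snd q) * snd p (snd q) else fst p q)
    \<in> histories t \<Otimes>\<^sub>M std_normals entries \<rightarrow>\<^sub>M (\<Pi>\<^sub>M i\<in>{..<Suc t} \<times> entries. borel)"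
  proof (rule measurable_restrict)
    fix q :: "nat \<times> nat \<times> nat" assume q: "q \<in> {..<Suc t} \<times> entries"
    obtain t' k j where [simp]: "q = (t', k, j)" by (cases q)
    have [measurable]: "(\<lambda>h. clipped D t h (k, j)) \<in> borel_measurable (histories t)"
      "(\<lambda>h. noise_sd t h (k, j)) \<in> borel_measurable (histories t)"
      using q by (auto intro!: measurable_clipped measurable_noise_sd D)
    have [measurable]: "(\<lambda>z. z (k, j)) \<in> borel_measurable (std_normals entries)"
      using q unfolding std_normals_def by simp
    have [measurable]: "(\<lambda>h. h (t', k, j)) \<in> borel_measurable (histories t)" if "t' \<noteq> t"
      using q that by (intro measurable_history) auto
    show "(\<lambda>p. if fst q = t then clipped D t (fst p) (snd q) + noise_sd t (fst p) (snd q) * snd p (snd q)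
        else fst p q) \<in> borel_measurable (histories t \<Otimes>\<^sub>M std_normals entries)"
      by (cases "t' = t") simp_all
  qed
qed

lemma noise_law_eq_distr:
  "noise_law m K c \<alpha> \<tau> T \<epsilon> \<delta> h t =
    distr (std_normals entries) (\<Pi>\<^sub>M i\<in>entries. borel) (\<lambda>z. \<lambda>i\<in>entries. noise_sd t h i * z i)"
proof -
  have "noise_law m K c \<alpha> \<tau> T \<epsilon> \<delta> h t = (\<Pi>\<^sub>M i\<in>entries. distr std_normal borel (\<lambda>z. noise_sd t h i * z))"
    unfolding noise_law_def
    using \<rho>_pos by (intro PiM_cong refl) (auto simp: noise_sd_def intro!: centred_normal_eq_distr)
  also have "\<dots> = distr (\<Pi>\<^sub>M i\<in>entries. std_normal) (\<Pi>\<^sub>M i\<in>entries. borel) (\<lambda>z. \<lambda>i\<in>entries. noise_sd t h i * z i)"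
    by (rule distr_PiM_componentwise[symmetric]) (auto intro: prob_space_std_normal)
  finally show ?thesis by (simp add: std_normals_def)
qed

lemma law_invariant:
  assumes D: "D \<in> {..<K} \<rightarrow> datasets"
  shows prob_space_law: "prob_space (law D t)"
    and sets_law: "sets (law D t) = sets (histories t)"
    and law_Suc: "law D (Suc t) = distr (law D t \<Otimes>\<^sub>M std_normals entries) (histories (Suc t)) (iterate D t)"
proof -
  have step: "law D (Suc t) = distr (law D t \<Otimes>\<^sub>M std_normals entries) (histories (Suc t)) (iterate D t)"
    if P: "prob_space (law D t)" and S [measurable_cong]: "sets (law D t) = sets (histories t)" for t
  proof -
    interpret N: prob_space "std_normals entries" by (rule prob_space_std_normals)
    have \<Phi> [measurable]: "iterate D t \<in> histories t \<Otimes>\<^sub>M std_normals entries \<rightarrow>\<^sub>M histories (Suc t)"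
      by (rule measurable_iterate[OF D])
    have "law D (Suc t) = law D t \<bind> (\<lambda>h. distr (std_normals entries) (histories (Suc t)) (\<lambda>z. iterate D t (h, z)))"
      unfolding run.simps
    proof (rule bind_cong[OF refl])
      fix h assume "h \<in> space (law D t)"
      then have h [measurable]: "h \<in> space (histories t)"
        using sets_eq_imp_space_eq[OF S] by simp
      have scale: "(\<lambda>z. \<lambda>i\<in>entries. noise_sd t h i * z i) \<in> std_normals entries \<rightarrow>\<^sub>M (\<Pi>\<^sub>M i\<in>entries. borel)"
        unfolding std_normals_def by (intro measurable_restrict) measurable
      have pub: "pub D t h \<in> (\<Pi>\<^sub>M i\<in>entries. borel) \<rightarrow>\<^sub>M histories (Suc t)"
        unfolding publish_def transcript_space_def split_beta'
        by (intro measurable_restrict) (auto simp: split_beta')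
      have "noise_law m K c \<alpha> \<tau> T \<epsilon> \<delta> h t \<bind> (\<lambda>w. return (histories (Suc t)) (pub D t h w))
          = distr (noise_law m K c \<alpha> \<tau> T \<epsilon> \<delta> h t) (histories (Suc t)) (pub D t h)"
        using pub by (intro bind_return_distr') (auto simp: noise_law_eq_distr space_PiM)
      also have "\<dots> = distr (std_normals entries) (histories (Suc t)) (\<lambda>z. iterate D t (h, z))"
        unfolding noise_law_eq_distr by (subst distr_distr[OF pub scale]) (simp add: iterate_def comp_def)
      finally show "noise_law m K c \<alpha> \<tau> T \<epsilon> \<delta> h t \<bind> (\<lambda>w. return (histories (Suc t)) (pub D t h w)) = \<dots>" .
    qed
    also have "\<dots> = distr (law D t \<Otimes>\<^sub>M std_normals entries) (histories (Suc t)) (iterate D t)"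
      by (rule bind_distr_eq_distr_pair[OF P N.prob_space_axioms]) measurable
    finally show ?thesis .
  qed
  have *: "prob_space (law D t) \<and> sets (law D t) = sets (histories t)" for t
  proof (induction t)
    case 0
    show ?case by (auto simp: transcript_space_def space_PiM intro!: prob_space_return)
  next
    case (Suc t)
    then have P: "prob_space (law D t)" and S [measurable_cong]: "sets (law D t) = sets (histories t)"
      by auto
    interpret P: prob_space "law D t" by (rule P)
    interpret N: prob_space "std_normals entries" by (rule prob_space_std_normals)
    interpret PN: pair_prob_space "law D t" "std_normals entries" ..
    have [measurable]: "iterate D t \<in> histories t \<Otimes>\<^sub>M std_normals entries \<rightarrow>\<^sub>M histories (Suc t)"
      by (rule measurable_iterate[OF D])
    have "prob_space (distr (law D t \<Otimes>\<^sub>M std_normals entries) (histories (Suc t)) (iterate D t))"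
      by (rule PN.prob_space_distr) measurable
    then show ?case
      unfolding step[OF P S] by simp
  qed
  show "prob_space (law D t)" "sets (law D t) = sets (histories t)"
    using * by auto
  show "law D (Suc t) = distr (law D t \<Otimes>\<^sub>M std_normals entries) (histories (Suc t)) (iterate D t)"
    using * by (intro step) auto
qed

section \<open>Changing the data of one party\<close>

lemma noise_sd_eq_0_iff: "noise_sd t h (k, j) = 0 \<longleftrightarrow> thr h t k j = 0"
  using \<rho>_pos m_pos T_pos by (simp add: noise_sd_def)

lemma noise_sd_square:
  "(noise_sd t h (k, j))\<^sup>2 = real T * real m * (thr h t k j)\<^sup>2 / (2 * privacy_budget \<epsilon> \<delta>)"
  using \<rho>_pos by (simp add: noise_sd_def)

text \<open>How far the noise must be shifted for \<open>D'\<close> to publish what \<open>D\<close> publishes. Where the noise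
  vanishes, division by zero makes the displacement 0.\<close>

definition displacement ::
  "(nat \<Rightarrow> dataset) \<Rightarrow> (nat \<Rightarrow> dataset) \<Rightarrow> nat \<Rightarrow> transcript \<Rightarrow> nat \<times> nat \<Rightarrow> real" where
  "displacement D D' t h i = (clipped D t h i - clipped D' t h i) / noise_sd t h i"

text \<open>The case without noise is not lost to the convention on division: the threshold is then 0, and
  clipping forces both allocations to be 0.\<close>

lemma clipped_eq_displaced:
  assumes "D \<in> {..<K} \<rightarrow> datasets" "D' \<in> {..<K} \<rightarrow> datasets" and "i \<in> entries"
  shows "clipped D t h i = clipped D' t h i + noise_sd t h i * displacement D D' t h i"
proof -
  obtain k j where i: "i = (k, j)" "k < K" "j < m" using assms by auto
  show ?thesis
  proof (cases "noise_sd t h i = 0")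
    case True
    then have "thr h t k j = 0" by (simp add: i noise_sd_eq_0_iff)
    moreover have "D k \<in> datasets" "D' k \<in> datasets"
      using assms i by auto
    ultimately show ?thesis
      using clipped_bounds[of D k j t h] clipped_bounds[of D' k j t h] i True by simp
  next
    case False
    then show ?thesis by (simp add: displacement_def)
  qed
qed

text \<open>Clipping makes the threshold a bound on the sensitivity, and the standard deviation of the noise
  is proportional to the same threshold. The adaptive threshold cancels.\<close>

lemma displacement_square_le:
  assumes "D k \<in> datasets" "D' k \<in> datasets" "k < K" "j < m"
  shows "(displacement D D' t h (k, j))\<^sup>2 / 2 \<le> privacy_budget \<epsilon> \<delta> / (real T * real m)"
proof (cases "thr h t k j = 0")
  case True
  then have "noise_sd t h (k, j) = 0" by (simp add: noise_sd_eq_0_iff)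
  then show ?thesis
    using \<rho>_pos by (simp add: displacement_def)
next
  case False
  have "\<bar>clipped D t h (k, j) - clipped D' t h (k, j)\<bar> \<le> \<bar>thr h t k j\<bar>"
    using clipped_bounds[of D k j t h] clipped_bounds[of D' k j t h] assms by auto
  then have "(clipped D t h (k, j) - clipped D' t h (k, j))\<^sup>2 \<le> (thr h t k j)\<^sup>2"
    by (rule abs_le_square_iff[THEN iffD1])
  then have "(displacement D D' t h (k, j))\<^sup>2 \<le> (thr h t k j)\<^sup>2 / (noise_sd t h (k, j))\<^sup>2"
    by (simp add: displacement_def power_divide divide_right_mono)
  also have "\<dots> = 2 * privacy_budget \<epsilon> \<delta> / (real T * real m)"
    using False \<rho>_pos m_pos T_pos by (simp add: noise_sd_square)
  finally show ?thesis by (simp add: mult.commute)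
qed

lemma sum_displacement_le:
  assumes "D p \<in> datasets" "D' p \<in> datasets" "p < K"
    and same: "\<And>k. k \<noteq> p \<Longrightarrow> D k = D' k"
  shows "(\<Sum>i\<in>entries. (displacement D D' t h i)\<^sup>2 / 2) \<le> privacy_budget \<epsilon> \<delta> / real T"
proof -
  have "(\<Sum>i\<in>entries. (displacement D D' t h i)\<^sup>2 / 2)
      = (\<Sum>k<K. \<Sum>j<m. (displacement D D' t h (k, j))\<^sup>2 / 2)"
    by (simp add: sum.cartesian_product)
  also have "\<dots> \<le> (\<Sum>k<K. \<Sum>j<m. if k = p then privacy_budget \<epsilon> \<delta> / (real T * real m) else 0)"
  proof (intro sum_mono)
    fix k j assume "k \<in> {..<K}" "j \<in> {..<m}"
    then show "(displacement D D' t h (k, j))\<^sup>2 / 2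
        \<le> (if k = p then privacy_budget \<epsilon> \<delta> / (real T * real m) else 0)"
      using displacement_square_le[of D k D' j t h] assms same[of k]
      by (auto simp: displacement_def clipped_def)
  qed
  also have "\<dots> = (\<Sum>k<K. if k = p then privacy_budget \<epsilon> \<delta> / real T else 0)"
    using m_pos by (intro sum.cong) auto
  also have "\<dots> = privacy_budget \<epsilon> \<delta> / real T"
    using assms by simp
  finally show ?thesis .
qed

text \<open>Given the published past, thresholds and multipliers coincide for both families of datasets, so
  a round differs only by the displacement of the noise of party \<open>p\<close>.\<close>

lemma law_renyi_bounded:
  assumes D: "D \<in> {..<K} \<rightarrow> datasets" and D': "D' \<in> {..<K} \<rightarrow> datasets"
    and p: "p < K" and same: "\<And>k. k \<noteq> p \<Longrightarrow> D k = D' k" and a: "1 \<le> a"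
  shows "renyi_bounded a (real t * (a * (privacy_budget \<epsilon> \<delta> / real T))) (law D t) (law D' t)"
proof (induction t)
  case 0
  have "law D 0 = law D' 0" by simp
  then show ?case
    using renyi_bounded_refl[OF prob_space_law[OF D', of 0]] by simp
next
  case (Suc t)
  note [measurable_cong] = sets_law[OF D] sets_law[OF D']
  (* The density of round t must be read off the transcript of t + 1 rounds. *)
  define past where "past y = (\<lambda>q\<in>{..<t} \<times> entries. y q)" for y :: transcript
  define noise where "noise y i = (y (t, i) - clipped D' t (past y) i) / noise_sd t (past y) i"
    for y :: transcript and i
  have space: "h \<in> space (law D' t) \<Longrightarrow> h \<in> ({..<t} \<times> entries) \<rightarrow>\<^sub>E UNIV" for h
    using sets_eq_imp_space_eq[OF sets_law[OF D', of t]] by (simp add: transcript_space_def space_PiM)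
  have "past \<in> histories (Suc t) \<rightarrow>\<^sub>M histories t"
    unfolding past_def transcript_space_def
    by (intro measurable_restrict measurable_component_singleton) auto
  then have past [measurable]: "past \<in> histories (Suc t) \<rightarrow>\<^sub>M law D' t"
    by measurable
  have past_iterate: "past (iterate D' t (h, z)) = h" if "h \<in> space (law D' t)" for h z
  proof
    show "past (iterate D' t (h, z)) q = h q" for q
      using PiE_arb[OF space[OF that], of q] by (auto simp: past_def iterate_apply restrict_def)
  qed
  have [measurable]: "(\<lambda>h. clipped D t h i) \<in> borel_measurable (law D' t)"
    "(\<lambda>h. clipped D' t h i) \<in> borel_measurable (law D' t)"
    "(\<lambda>h. noise_sd t h i) \<in> borel_measurable (law D' t)" if i: "i \<in> entries" for i
    using measurable_clipped[OF D i] measurable_clipped[OF D' i] measurable_noise_sd[OF i]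
    by measurable
  have "renyi_bounded a (real t * (a * (privacy_budget \<epsilon> \<delta> / real T)) + a * (privacy_budget \<epsilon> \<delta> / real T))
    (distr (law D t \<Otimes>\<^sub>M std_normals entries) (histories (Suc t))
      (\<lambda>(h, z). iterate D' t (h, translate entries (displacement D D' t h) z)))
    (distr (law D' t \<Otimes>\<^sub>M std_normals entries) (histories (Suc t)) (iterate D' t))"
  proof (rule renyi_bounded_gaussian_step[where past = past and noise = noise])
    show "renyi_bounded a (real t * (a * (privacy_budget \<epsilon> \<delta> / real T))) (law D t) (law D' t)"
      by (rule Suc.IH)
    show "prob_space (law D t)" "prob_space (law D' t)"
      using D D' by (auto intro: prob_space_law)
    show "(\<Sum>i\<in>entries. (displacement D D' t h i)\<^sup>2 / 2) \<le> privacy_budget \<epsilon> \<delta> / real T" for h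
      using D D' p same by (intro sum_displacement_le) auto
    show "iterate D' t \<in> law D' t \<Otimes>\<^sub>M std_normals entries \<rightarrow>\<^sub>M histories (Suc t)"
      using measurable_iterate[OF D'] by measurable
    show "(\<lambda>h. displacement D D' t h i) \<in> borel_measurable (law D' t)" if "i \<in> entries" for i
      unfolding displacement_def using that by measurable
    show "(\<lambda>y. noise y i) \<in> borel_measurable (histories (Suc t))" if i: "i \<in> entries" for i
    proof -
      have [measurable]: "(\<lambda>y. y (t, i)) \<in> borel_measurable (histories (Suc t))"
        using i by (cases i) auto
      show ?thesis unfolding noise_def using i by measurable
    qed
    show "noise (iterate D' t (h, z)) i = z i"
      if "h \<in> space (law D' t)" "i \<in> entries" "displacement D D' t h i \<noteq> 0" for h z i
    proof -
      have "iterate D' t (h, z) (t, i) = clipped D' t h i + noise_sd t h i * z i"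
        using that by (simp add: iterate_apply)
      then show ?thesis
        using that by (simp add: noise_def past_iterate displacement_def)
    qed
  qed (auto simp: a past_iterate)
  also have "distr (law D t \<Otimes>\<^sub>M std_normals entries) (histories (Suc t))
      (\<lambda>(h, z). iterate D' t (h, translate entries (displacement D D' t h) z)) = law D (Suc t)"
    unfolding law_Suc[OF D]
  proof (intro distr_cong refl)
    have "iterate D' t (h, translate entries (displacement D D' t h) z) = iterate D t (h, z)" for h z
      by (rule ext)
         (auto simp: iterate_apply translate_def clipped_eq_displaced[OF D D'] algebra_simps restrict_def)
    then show "(case q of (h, z) \<Rightarrow> iterate D' t (h, translate entries (displacement D D' t h) z)) = iterate D t q" for q
      by (cases q) simp
  qed
  finally show ?case
    unfolding law_Suc[OF D'] by (simp add: algebra_simps add_divide_distrib del: run.simps)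
qed

text \<open>After \<open>T\<close> rounds the divergence of order \<open>a\<close> is at most \<open>a\<close> times the budget, and the
  budget is chosen so that the best \<open>a\<close> yields exactly \<open>\<delta>\<close>. For \<open>\<delta> = 1\<close> there is no such order, but
  there the bound is trivial.\<close>

lemma law_hockey_stick:
  assumes D: "D \<in> {..<K} \<rightarrow> datasets" and D': "D' \<in> {..<K} \<rightarrow> datasets"
    and p: "p < K" and same: "\<And>k. k \<noteq> p \<Longrightarrow> D k = D' k"
    and \<epsilon>: "0 < \<epsilon>" and \<delta>: "0 < \<delta>" "\<delta> \<le> 1" and S: "S \<in> sets (histories T)"
  shows "measure (law D T) S \<le> exp \<epsilon> * measure (law D' T) S + \<delta>"
proof (cases "\<delta> = 1")
  case True
  have "measure (law D T) S \<le> 1"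
    using prob_space_law[OF D] by (rule prob_space.prob_le_1)
  also have "1 \<le> exp \<epsilon> * measure (law D' T) S + \<delta>"
    using True by simp
  finally show ?thesis .
next
  case False
  then obtain a where a: "1 < a" and order: "exp ((a - 1) * (a * privacy_budget \<epsilon> \<delta> - \<epsilon>)) = \<delta>"
    using privacy_budget_order[of \<epsilon> \<delta>] \<epsilon> \<delta> by auto
  have "renyi_bounded a (real T * (a * (privacy_budget \<epsilon> \<delta> / real T))) (law D T) (law D' T)"
    using a p same by (intro law_renyi_bounded D D') auto
  then have "renyi_bounded a (a * privacy_budget \<epsilon> \<delta>) (law D T) (law D' T)"
    using T_pos by simp
  from renyi_bounded_imp_hockey_stick[OF this a, of S \<epsilon>] show ?thesis
    using S order prob_space_law[OF D] prob_space_law[OF D'] sets_law[OF D']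
    by (auto simp: prob_space.finite_measure)
qed

end

theorem corollary2p1:
  fixes m K T :: nat and c :: "real vec" and \<alpha> \<tau> \<gamma> \<epsilon> \<delta> :: real and \<nu> :: "nat \<Rightarrow> real"
    and argmax :: "real vec \<Rightarrow> dataset \<Rightarrow> real vec \<times> real vec"
  assumes "K > 1" and "m \<ge> 1"
    and "c \<in> carrier_vec m" and "0\<^sub>v m \<le> c"
    and "argmax_selection m c argmax"
    and "\<And>t. \<nu> t > 0" and "\<gamma> \<ge> 0"
    and "\<epsilon> > 0" and "0 < \<delta>" and "\<delta> \<le> 1"
    and "T \<ge> 1" and "\<alpha> \<ge> 1" and "\<tau> > 0"
  shows "multiparty_locally_private K (possible_datasets m c) (transcript_space m K T) \<epsilon> \<delta>
    (\<lambda>D. run m K c \<alpha> \<tau> \<nu> \<gamma> T \<epsilon> \<delta> argmax D T)"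
proof -
  interpret resource_sharing m K T c \<alpha> \<tau> \<gamma> \<epsilon> \<delta> \<nu> argmax
    using assms privacy_budget_pos[of \<epsilon> \<delta>] by unfold_locales auto
  show ?thesis
    unfolding multiparty_locally_private_def locally_private_def
  proof (intro allI impI ballI)
    fix k D d d' S
    assume "k < K" and "\<forall>i<K. i \<noteq> k \<longrightarrow> D i \<in> possible_datasets m c"
      and "d \<in> possible_datasets m c" and "d' \<in> possible_datasets m c"
      and "S \<in> sets (transcript_space m K T)"
    then show "measure (law (D(k := d)) T) S \<le> exp \<epsilon> * measure (law (D(k := d')) T) S + \<delta>"
      using assms by (intro law_hockey_stick[where p = k]) auto
  qed
qed

end
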